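(* Let $(g^c)_{c\ge 0}$ and $(h^b)_{b\ge 0}$ be the families of metrics on $M=\mathbb{R}_{>0}\times\mathbb{R}^3$ defined in the context. For every $c>0$, setting $b=1/c$, the metric $g^c$ is transformed into $h^b$ by the change of coordinates $$(\rho,\tilde\phi,\zeta^0,\tilde\zeta_0)=(\rho',\tilde\phi',\sqrt b\,\zeta'^0,\sqrt b\,\tilde\zeta'_0).$$ The family $h^b$, $b>0$, extends to $b=0$, where $$h^0=\frac{1}{4\rho'^2}\left[2\,d\rho'^2+\tfrac12\,d\tilde\phi'^2+4(d\tilde\zeta'_0)^2+4(d\zeta'^0)^2\right],$$ and $h^0$ has constant sectional curvature $-2$ (it is a real hyperbolic metric). In this sense, the limit $c\to\infty$ of $g^c$ is, after the parameter-dependent change of coordinates $(\rho,\tilde\phi,\zeta^0,\tilde\zeta_0)=(\rho',\tilde\phi',\sqrt b\,\zeta'^0,\sqrt b\,\tilde\zeta'_0)$ with $b=1/c$, well-defined and equal to $h^0$.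
   Context: With coordinates $(\rho,\tilde\phi,\zeta^0,\tilde\zeta_0)$ on $M=\mathbb{R}_{>0}\times\mathbb{R}^3$, for $c\ge0$, $$g^c=\frac{1}{4\rho^2}\left[\frac{\rho+2c}{\rho+c}\,d\rho^2+\frac{\rho+c}{\rho+2c}\,(d\tilde\phi+\zeta^0 d\tilde\zeta_0-\tilde\zeta_0 d\zeta^0)^2+2(\rho+2c)\left((d\tilde\zeta_0)^2+(d\zeta^0)^2\right)\right].$$ With coordinates $(\rho',\tilde\phi',\zeta'^0,\tilde\zeta'_0)$ on $M$, $\rho'>0$, for $b\ge 0$, $$h^b=\frac{1}{4\rho'^2}\left[\frac{b\rho'+2}{b\rho'+1}\,d\rho'^2+\frac{b\rho'+1}{b\rho'+2}\,(d\tilde\phi'+b\zeta'^0 d\tilde\zeta'_0-b\tilde\zeta'_0 d\zeta'^0)^2+2(b\rho'+2)\left((d\tilde\zeta'_0)^2+(d\zeta'^0)^2\right)\right].$$ *)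

theory Defs
  imports "HOL-Analysis.Analysis"
begin

section \<open>Smooth maps\<close>

text \<open>\<open>C_diff_on k U f\<close> is \<open>C^k\<close>-regularity on an open set \<open>U\<close>: all iterated directional
  derivatives up to order \<open>k\<close> exist and are continuous.\<close>

fun C_diff_on ::
    "nat \<Rightarrow> 'a::real_normed_vector set \<Rightarrow> ('a \<Rightarrow> 'b::real_normed_vector) \<Rightarrow> bool" where
  "C_diff_on 0 U f \<longleftrightarrow> continuous_on U f"
| "C_diff_on (Suc k) U f \<longleftrightarrow>
     (\<forall>x\<in>U. f differentiable (at x)) \<and>
     (\<forall>v. C_diff_on k U (\<lambda>x. frechet_derivative f (at x) v))"

text \<open>On a set that is not open (such as \<open>[0,\<infinity>) \<times> M\<close>) smoothness means having a smooth
  extension to an open neighbourhood; on an open set this is the usual notion, and the values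
  of \<open>f\<close> off the set are irrelevant.\<close>

definition smooth_on ::
    "'a::real_normed_vector set \<Rightarrow> ('a \<Rightarrow> 'b::real_normed_vector) \<Rightarrow> bool" where
  "smooth_on S f \<longleftrightarrow>
     (\<exists>U F. open U \<and> S \<subseteq> U \<and> (\<forall>x\<in>S. F x = f x) \<and> (\<forall>k. C_diff_on k U F))"

definition diffeomorphism_on ::
    "'a::real_normed_vector set \<Rightarrow> 'b::real_normed_vector set \<Rightarrow> ('a \<Rightarrow> 'b) \<Rightarrow> bool" where
  "diffeomorphism_on S T f \<longleftrightarrow>
     bij_betw f S T \<and> smooth_on S f \<and> smooth_on T (inv_into S f)"


section \<open>Riemannian metrics on open subsets of Euclidean space\<close>

text \<open>A metric is a field of bilinear forms: \<open>g p v w\<close> pairs the tangent vectors \<open>v\<close>, \<open>w\<close> at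
  the point \<open>p\<close>, given by their components in the coordinate frame.\<close>

type_synonym 'n metric_field = "real^'n \<Rightarrow> real^'n \<Rightarrow> real^'n \<Rightarrow> real"

definition riemannian_metric_on :: "(real^'n) set \<Rightarrow> 'n::finite metric_field \<Rightarrow> bool" where
  "riemannian_metric_on S g \<longleftrightarrow>
     (\<forall>p\<in>S. bilinear (g p) \<and> (\<forall>v w. g p v w = g p w v) \<and> (\<forall>v. v \<noteq> 0 \<longrightarrow> 0 < g p v v)) \<and>
     (\<forall>v w. smooth_on S (\<lambda>p. g p v w))"

definition pullback ::
    "(real^'m \<Rightarrow> real^'n) \<Rightarrow> 'n::finite metric_field \<Rightarrow> 'm::finite metric_field" where
  "pullback f g p v w =
     g (f p) (frechet_derivative f (at p) v) (frechet_derivative f (at p) w)"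

definition pderiv_at :: "'n::finite \<Rightarrow> (real^'n \<Rightarrow> real) \<Rightarrow> real^'n \<Rightarrow> real" where
  "pderiv_at i f p = frechet_derivative f (at p) (axis i 1)"

definition gram :: "'n::finite metric_field \<Rightarrow> real^'n \<Rightarrow> real^'n^'n" where
  "gram g p = (\<chi> i j. g p (axis i 1) (axis j 1))"

text \<open>\<open>christoffel g k i j\<close> is \<open>\<Gamma>\<^sup>k\<^sub>i\<^sub>j\<close>, the components of the Levi-Civita connection.\<close>

definition christoffel ::
    "'n::finite metric_field \<Rightarrow> 'n \<Rightarrow> 'n \<Rightarrow> 'n \<Rightarrow> real^'n \<Rightarrow> real" where
  "christoffel g k i j p =
     (1/2) * (\<Sum>l\<in>UNIV. matrix_inv (gram g p) $ k $ l *
        (pderiv_at i (\<lambda>q. gram g q $ j $ l) p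
         + pderiv_at j (\<lambda>q. gram g q $ i $ l) p
         - pderiv_at l (\<lambda>q. gram g q $ i $ j) p))"

text \<open>\<open>riemann_coeff g l i j k\<close> is the coefficient of \<open>\<partial>\<^sub>l\<close> in \<open>R(\<partial>\<^sub>i,\<partial>\<^sub>j)\<partial>\<^sub>k\<close>, with the convention
  \<open>R(X,Y)Z = \<nabla>\<^sub>X\<nabla>\<^sub>YZ - \<nabla>\<^sub>Y\<nabla>\<^sub>XZ - \<nabla>\<^bsub>[X,Y]\<^esub>Z\<close>.\<close>

definition riemann_coeff ::
    "'n::finite metric_field \<Rightarrow> 'n \<Rightarrow> 'n \<Rightarrow> 'n \<Rightarrow> 'n \<Rightarrow> real^'n \<Rightarrow> real" where
  "riemann_coeff g l i j k p =
     pderiv_at i (christoffel g l j k) p - pderiv_at j (christoffel g l i k) p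
     + (\<Sum>m\<in>UNIV. christoffel g l i m p * christoffel g m j k p
               - christoffel g l j m p * christoffel g m i k p)"

definition riemann ::
    "'n::finite metric_field \<Rightarrow> real^'n \<Rightarrow> real^'n \<Rightarrow> real^'n \<Rightarrow> real^'n \<Rightarrow> real^'n" where
  "riemann g p u v w =
     (\<chi> l. \<Sum>i\<in>UNIV. \<Sum>j\<in>UNIV. \<Sum>k\<in>UNIV. riemann_coeff g l i j k p * u $ i * v $ j * w $ k)"

definition sectional_curvature ::
    "'n::finite metric_field \<Rightarrow> real^'n \<Rightarrow> real^'n \<Rightarrow> real^'n \<Rightarrow> real" where
  "sectional_curvature g p u v =
     g p (riemann g p u v v) u / (g p u u * g p v v - (g p u v)\<^sup>2)"

definition constant_sectional_curvature_on ::
    "(real^'n) set \<Rightarrow> 'n::finite metric_field \<Rightarrow> real \<Rightarrow> bool" where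
  "constant_sectional_curvature_on S g \<kappa> \<longleftrightarrow>
     (\<forall>p\<in>S. \<forall>u v. u \<noteq> v \<and> independent {u, v} \<longrightarrow> sectional_curvature g p u v = \<kappa>)"


section \<open>The metrics\<close>

text \<open>A point \<open>p :: real^4\<close> has coordinates \<open>p $ 1 = \<rho>\<close>, \<open>p $ 2 = \<phi>\<close> (with tilde),
  \<open>p $ 3 = \<zeta>\<^sup>0\<close>, \<open>p $ 4 = \<zeta>\<^sub>0\<close> (with tilde); the differentials of the coordinates, evaluated on
  a tangent vector \<open>v\<close>, are \<open>v $ 1\<close>, ..., \<open>v $ 4\<close>.\<close>

definition M :: "(real^4) set" where
  "M = {p. 0 < p $ 1}"

definition fibre_form :: "real \<Rightarrow> real^4 \<Rightarrow> real^4 \<Rightarrow> real" where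
  "fibre_form s p v = v $ 2 + s * p $ 3 * v $ 4 - s * p $ 4 * v $ 3"

definition g_metric :: "real \<Rightarrow> 4 metric_field" where
  "g_metric c p v w = (let \<rho> = p $ 1 in
     1 / (4 * \<rho>\<^sup>2) *
       ((\<rho> + 2 * c) / (\<rho> + c) * (v $ 1 * w $ 1)
        + (\<rho> + c) / (\<rho> + 2 * c) * (fibre_form 1 p v * fibre_form 1 p w)
        + 2 * (\<rho> + 2 * c) * (v $ 4 * w $ 4 + v $ 3 * w $ 3)))"

definition h_metric :: "real \<Rightarrow> 4 metric_field" where
  "h_metric b p v w = (let \<rho> = p $ 1 in
     1 / (4 * \<rho>\<^sup>2) *
       ((b * \<rho> + 2) / (b * \<rho> + 1) * (v $ 1 * w $ 1)
        + (b * \<rho> + 1) / (b * \<rho> + 2) * (fibre_form b p v * fibre_form b p w)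
        + 2 * (b * \<rho> + 2) * (v $ 4 * w $ 4 + v $ 3 * w $ 3)))"

text \<open>The primed coordinates are the source: \<open>(\<rho>, \<phi>, \<zeta>\<^sup>0, \<zeta>\<^sub>0) = coord_change b (\<rho>', \<phi>', \<zeta>'\<^sup>0, \<zeta>'\<^sub>0)\<close>.\<close>

definition coord_change :: "real \<Rightarrow> real^4 \<Rightarrow> real^4" where
  "coord_change b p = vector [p $ 1, p $ 2, sqrt b * p $ 3, sqrt b * p $ 4]"

text \<open>The upper half-space model, on \<open>M\<close>, of the real hyperbolic space of curvature \<open>\<kappa> < 0\<close>.\<close>

definition half_space_metric :: "real \<Rightarrow> 4 metric_field" where
  "half_space_metric \<kappa> p v w = (v \<bullet> w) / (- \<kappa> * (p $ 1)\<^sup>2)"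

end

theory Submission
  imports Defs
begin

text \<open>With \<open>b = 1/c\<close> the quotients in \<open>g\<^sup>c\<close> become those of \<open>h\<^sup>b\<close> after multiplying numerator and
  denominator by \<open>b\<close>, and rescaling both fibre coordinates by \<open>sqrt b\<close> produces exactly the factor
  \<open>b\<close> in the fibre form and in the last summand (\<open>pullback_coord_change\<close>). In this form the
  coefficients are rational in \<open>(b, p)\<close> and have no pole where \<open>\<rho> > 0\<close> and \<open>b\<rho> + 1 > 0\<close>, an open
  set containing \<open>[0,\<infinity>) \<times> M\<close>; hence the family is smooth up to \<open>b = 0\<close>
  (\<open>smooth_on_h_metric\<close>), and by uniform continuity on \<open>[0,1] \<times> K\<close> it converges uniformly on every
  compact \<open>K\<close> (\<open>uniform_limit_h_metric\<close>).

  At \<open>b = 0\<close> the twisting of the fibre disappears and the metric is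
  \<open>(\<Sum>i. a\<^sub>i dx\<^sub>i\<^sup>2) / \<rho>\<^sup>2\<close> with constants \<open>a\<^sub>i > 0\<close>. Rescaling the coordinates other than \<open>\<rho>\<close>
  turns all \<open>a\<^sub>i\<close> into \<open>a\<^sub>\<rho>\<close>, which gives the half-space model of curvature \<open>-1/a\<^sub>\<rho>\<close>; here
  \<open>a\<^sub>\<rho> = 1/2\<close>. The curvature itself is computed directly for all such metrics, in any dimension:
  the Christoffel symbols are constants divided by \<open>\<rho>\<close>, so the curvature tensor reduces to a
  finite identity between Kronecker deltas (\<open>riemann_coeff_diag_metric\<close>), which says that
  \<open>R(u,v)w = -1/a\<^sub>\<rho> (g(v,w) u - g(u,w) v)\<close>.\<close>

section \<open>Smoothness of rational expressions\<close>

lemma C_diff_on_cong: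
  assumes U: "open U" and eq: "\<And>x. x \<in> U \<Longrightarrow> f x = g x"
  shows "C_diff_on k U f \<longleftrightarrow> C_diff_on k U g"
  using eq
proof (induction k arbitrary: f g)
  case 0
  then show ?case by (simp cong: continuous_on_cong)
next
  case (Suc k)
  have D: "(f has_derivative D) (at x) \<longleftrightarrow> (g has_derivative D) (at x)" if "x \<in> U" for x D
    using has_derivative_transform_within_open[OF _ U that, of f D UNIV g]
      has_derivative_transform_within_open[OF _ U that, of g D UNIV f] Suc.prems by auto
  have "C_diff_on k U (\<lambda>x. frechet_derivative f (at x) v)
      \<longleftrightarrow> C_diff_on k U (\<lambda>x. frechet_derivative g (at x) v)" for v
    by (rule Suc.IH) (simp add: frechet_derivative_def D)
  then show ?case by (simp add: differentiable_def D)
qed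

text \<open>The class is generated by operations whose derivatives stay in the class. Therefore one induction
  (\<open>rational_on_derivative\<close>) yields derivatives of every order, and no Leibniz rule for \<open>C\<^sup>k\<close>
  functions has to be iterated.\<close>

inductive rational_on :: "'a::real_normed_vector set \<Rightarrow> ('a \<Rightarrow> real) \<Rightarrow> bool"
  for U where
  const: "rational_on U (\<lambda>x. c)"
| linear: "bounded_linear f \<Longrightarrow> rational_on U f"
| add: "rational_on U f \<Longrightarrow> rational_on U g \<Longrightarrow> rational_on U (\<lambda>x. f x + g x)"
| mult: "rational_on U f \<Longrightarrow> rational_on U g \<Longrightarrow> rational_on U (\<lambda>x. f x * g x)"
| inverse: "rational_on U f \<Longrightarrow> \<forall>x\<in>U. f x \<noteq> 0 \<Longrightarrow> rational_on U (\<lambda>x. inverse (f x))"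

lemma rational_on_minus: "rational_on U f \<Longrightarrow> rational_on U (\<lambda>x. - f x)"
  using rational_on.mult[OF rational_on.const[of U "-1"]] by fastforce

lemma rational_on_diff:
  "rational_on U f \<Longrightarrow> rational_on U g \<Longrightarrow> rational_on U (\<lambda>x. f x - g x)"
  using rational_on.add[OF _ rational_on_minus] by fastforce

lemma rational_on_divide:
  "rational_on U f \<Longrightarrow> rational_on U g \<Longrightarrow> \<forall>x\<in>U. g x \<noteq> 0 \<Longrightarrow> rational_on U (\<lambda>x. f x / g x)"
  unfolding divide_inverse by (intro rational_on.mult rational_on.inverse)

lemma rational_on_power: "rational_on U f \<Longrightarrow> rational_on U (\<lambda>x. f x ^ n)"
  by (induction n) (auto intro: rational_on.const rational_on.mult)

lemma rational_on_derivative: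
  assumes "rational_on U f"
  shows "\<exists>f'. (\<forall>x\<in>U. (f has_derivative f' x) (at x)) \<and> (\<forall>v. rational_on U (\<lambda>x. f' x v))"
  using assms
proof induction
  case (const c)
  show ?case
    by (rule exI[of _ "\<lambda>x v. 0"]) (auto intro: rational_on.const)
next
  case (linear f)
  then show ?case
    by (intro exI[of _ "\<lambda>x. f"]) (auto intro: rational_on.const bounded_linear_imp_has_derivative)
next
  case (add f g)
  then obtain f' g' where
    "\<forall>x\<in>U. (f has_derivative f' x) (at x)" "\<forall>v. rational_on U (\<lambda>x. f' x v)"
    "\<forall>x\<in>U. (g has_derivative g' x) (at x)" "\<forall>v. rational_on U (\<lambda>x. g' x v)" by blast
  then show ?case
    by (intro exI[of _ "\<lambda>x v. f' x v + g' x v"])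
      (auto intro!: rational_on.add has_derivative_add)
next
  case (mult f g)
  then obtain f' g' where
    "\<forall>x\<in>U. (f has_derivative f' x) (at x)" "\<forall>v. rational_on U (\<lambda>x. f' x v)"
    "\<forall>x\<in>U. (g has_derivative g' x) (at x)" "\<forall>v. rational_on U (\<lambda>x. g' x v)" by blast
  with mult.hyps show ?case
    by (intro exI[of _ "\<lambda>x v. f x * g' x v + f' x v * g x"])
      (auto intro!: rational_on.add rational_on.mult has_derivative_mult)
next
  case (inverse f)
  then obtain f' where
    "\<And>x. x \<in> U \<Longrightarrow> (f has_derivative f' x) (at x)" "\<And>v. rational_on U (\<lambda>x. f' x v)" by blast
  with inverse.hyps show ?case
    by (intro exI[of _ "\<lambda>x v. - (inverse (f x) * f' x v * inverse (f x))"] conjI ballI allI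
        Deriv.has_derivative_inverse rational_on_minus rational_on.mult rational_on.inverse) auto
qed

lemma rational_on_imp_C_diff_on:
  assumes U: "open U" and "rational_on U f"
  shows "C_diff_on k U f"
  using assms(2)
proof (induction k arbitrary: f)
  case 0
  then obtain f' where "\<forall>x\<in>U. (f has_derivative f' x) (at x)"
    using rational_on_derivative by blast
  then show ?case
    by (auto intro!: continuous_at_imp_continuous_on intro: has_derivative_continuous)
next
  case (Suc k)
  obtain f' where f': "\<And>x. x \<in> U \<Longrightarrow> (f has_derivative f' x) (at x)"
    and r: "\<And>v. rational_on U (\<lambda>x. f' x v)"
    using rational_on_derivative[OF Suc.prems] by blast
  have "C_diff_on k U (\<lambda>x. frechet_derivative f (at x) v)" for v
  proof (rule C_diff_on_cong[OF U, THEN iffD2])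
    show "C_diff_on k U (\<lambda>x. f' x v)" by (rule Suc.IH[OF r])
    show "frechet_derivative f (at x) v = f' x v" if "x \<in> U" for x
      using frechet_derivative_at[OF f'[OF that]] by simp
  qed
  with f' show ?case by (auto simp: differentiable_def)
qed

lemma C_diff_on_const: "C_diff_on k U (\<lambda>x. c)"
  by (induction k arbitrary: c) (auto simp: frechet_derivative_const)

lemma C_diff_on_linear:
  assumes f: "bounded_linear f"
  shows "C_diff_on k U f"
proof (cases k)
  case 0
  then show ?thesis by (simp add: linear_continuous_on f)
next
  case (Suc m)
  have "frechet_derivative f (at x) = f" for x
    using frechet_derivative_at[OF bounded_linear_imp_has_derivative[OF f]] by simp
  then show ?thesis
    using Suc bounded_linear_imp_differentiable[OF f] by (auto simp: C_diff_on_const)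
qed

section \<open>Diagonal linear maps of the half-space\<close>

definition stretch :: "('n \<Rightarrow> real) \<Rightarrow> real^'n \<Rightarrow> real^'n::finite" where
  "stretch s p = (\<chi> i. s i * p $ i)"

lemma bounded_linear_stretch: "bounded_linear (stretch s)"
  unfolding linear_conv_bounded_linear[symmetric]
  by (intro linearI) (auto simp: stretch_def vec_eq_iff algebra_simps)

lemma pullback_stretch: "pullback (stretch s) g p v w = g (stretch s p) (stretch s v) (stretch s w)"
  using frechet_derivative_at[OF bounded_linear_imp_has_derivative[OF bounded_linear_stretch[of s]]]
  by (simp add: pullback_def)

lemma open_M: "open M"
  unfolding M_def by (intro open_Collect_less continuous_intros)

text \<open>The condition \<open>s 1 = 1\<close> keeps the first coordinate, the only one that the definition of \<open>M\<close>
  constrains.\<close>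

lemma diffeomorphism_on_stretch:
  assumes s: "\<And>i. s i \<noteq> 0" and s1: "s 1 = 1"
  shows "diffeomorphism_on M M (stretch s)"
proof -
  have smooth: "C_diff_on k M (stretch t)" for k t
    by (rule C_diff_on_linear[OF bounded_linear_stretch])
  let ?t = "\<lambda>i. 1 / s i"
  have t: "stretch ?t (stretch s p) = p" "stretch s (stretch ?t p) = p" for p
    using s by (simp_all add: stretch_def)
  have M: "stretch s p \<in> M \<longleftrightarrow> p \<in> M" "stretch ?t p \<in> M \<longleftrightarrow> p \<in> M" for p
    using s1 by (simp_all add: M_def stretch_def)
  have bij: "bij_betw (stretch s) M M"
    by (rule bij_betw_byWitness[of _ "stretch ?t"]) (auto simp: t M)
  have inv: "stretch ?t p = inv_into M (stretch s) p" if "p \<in> M" for p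
    by (rule sym, rule inv_into_f_eq) (use bij t M that in \<open>auto simp: bij_betw_def\<close>)
  show ?thesis
    unfolding diffeomorphism_on_def smooth_on_def
    using bij inv smooth open_M by blast
qed

lemma coord_change_nth [simp]:
  "coord_change b p $ 1 = p $ 1" "coord_change b p $ 2 = p $ 2"
  "coord_change b p $ 3 = sqrt b * p $ 3" "coord_change b p $ 4 = sqrt b * p $ 4"
  by (simp_all add: coord_change_def vector_def)

lemma coord_change_eq_stretch:
  "coord_change b = stretch (\<lambda>i. if i = 3 \<or> i = 4 then sqrt b else 1)"
  by (rule ext) (simp add: stretch_def vec_eq_iff forall_4)

section \<open>Smoothness and convergence of the families of metrics\<close>

lemma pullback_coord_change:
  assumes "c > 0" "p \<in> M"
  shows "pullback (coord_change (1 / c)) (g_metric c) p v w = h_metric (1 / c) p v w"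
proof -
  have f: "fibre_form 1 (coord_change (1/c) p) (coord_change (1/c) v) = fibre_form (1/c) p v" for v
    using assms by (simp add: fibre_form_def real_sqrt_divide)
  have r: "p $ 1 > 0" using assms by (simp add: M_def)
  have "pullback (coord_change (1 / c)) (g_metric c) p v w =
     g_metric c (coord_change (1/c) p) (coord_change (1/c) v) (coord_change (1/c) w)"
    unfolding coord_change_eq_stretch by (rule pullback_stretch)
  also have "\<dots> = h_metric (1 / c) p v w"
  proof -
    have 1: "(p $ 1 + 2 * c) / (p $ 1 + c) = (1 / c * p $ 1 + 2) / (1 / c * p $ 1 + 1)"
      using r assms(1) by (simp add: divide_simps add_nonneg_eq_0_iff algebra_simps)
    have 2: "(p $ 1 + c) / (p $ 1 + 2 * c) = (1 / c * p $ 1 + 1) / (1 / c * p $ 1 + 2)"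
      using r assms(1) by (simp add: divide_simps add_nonneg_eq_0_iff algebra_simps)
    have 3: "2 * (p $ 1 + 2 * c) * (sqrt (1/c) * x * (sqrt (1/c) * y) + sqrt (1/c) * x' * (sqrt (1/c) * y'))
      = 2 * (1 / c * p $ 1 + 2) * (x * y + x' * y')" for x y x' y'
    proof -
      have "sqrt (1/c) * x * (sqrt (1/c) * y) + sqrt (1/c) * x' * (sqrt (1/c) * y')
          = (sqrt (1/c) * sqrt (1/c)) * (x * y + x' * y')" by (simp only: algebra_simps)
      also have "\<dots> = 1/c * (x * y + x' * y')" using assms(1) by simp
      finally show ?thesis using assms(1) by (simp add: field_simps)
    qed
    show ?thesis
      unfolding g_metric_def h_metric_def Let_def f coord_change_nth 1 2 3 ..
  qed
  finally show ?thesis .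
qed

text \<open>Stated along arbitrary rational maps \<open>\<beta>\<close> and \<open>P\<close> so that it covers both the joint dependence
  on \<open>(b, p)\<close> and the dependence on \<open>p\<close> for fixed \<open>b\<close>.\<close>

lemma rational_on_h_metric:
  assumes b: "rational_on U \<beta>" and P: "\<And>i. rational_on U (\<lambda>x. P x $ i)"
    and pos: "\<And>x. x \<in> U \<Longrightarrow> 0 < P x $ 1" "\<And>x. x \<in> U \<Longrightarrow> 0 < \<beta> x * P x $ 1 + 1"
  shows "rational_on U (\<lambda>x. h_metric (\<beta> x) (P x) v w)"
proof -
  have "\<beta> x * P x $ 1 + 2 \<noteq> 0" if "x \<in> U" for x using pos(2)[OF that] by simp
  with pos show ?thesis
    unfolding h_metric_def Let_def fibre_form_def
    by (intro rational_on.intros(1,3,4) rational_on_diff rational_on_divide rational_on_power b P ballI)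
      (force simp: less_imp_neq[symmetric])+
qed

lemma smooth_on_h_metric: "smooth_on ({0..} \<times> M) (\<lambda>(b, p). h_metric b p v w)"
proof -
  \<comment> \<open>\<open>U\<close> reaches beyond \<open>b = 0\<close> to small negative \<open>b\<close>, as long as \<open>b\<rho> + 1\<close> stays positive.\<close>
  define U :: "(real \<times> (real^4)) set" where "U = {x. 0 < snd x $ 1 \<and> 0 < fst x * snd x $ 1 + 1}"
  have U: "open U"
    unfolding U_def by (intro open_Collect_conj open_Collect_less continuous_intros)
  have sub: "{0..} \<times> M \<subseteq> U"
    by (auto simp: U_def M_def add_nonneg_pos)
  have "bounded_linear (\<lambda>x::real \<times> (real^4). snd x $ i)" for i
    by (rule bounded_linear_compose[OF bounded_linear_vec_nth bounded_linear_snd])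
  then have "rational_on U (\<lambda>x. h_metric (fst x) (snd x) v w)"
    by (intro rational_on_h_metric rational_on.linear bounded_linear_fst) (auto simp: U_def)
  then show ?thesis
    unfolding smooth_on_def using U sub rational_on_imp_C_diff_on
    by (intro exI[of _ U] exI[of _ "\<lambda>x. h_metric (fst x) (snd x) v w"]) auto
qed

lemma riemannian_metric_on_h_metric:
  assumes b: "b \<ge> 0"
  shows "riemannian_metric_on M (h_metric b)"
proof -
  have bil: "bilinear (h_metric b p)" for p
    unfolding bilinear_def h_metric_def Let_def fibre_form_def
    by (auto intro!: linearI simp: algebra_simps add_divide_distrib diff_divide_distrib)
  have sym: "h_metric b p v w = h_metric b p w v" for p v w
    by (simp add: h_metric_def Let_def algebra_simps)
  have pos: "0 < h_metric b p v v" if p: "p \<in> M" and v: "v \<noteq> 0" for p v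
  proof -
    let ?r = "p $ 1" let ?f = "fibre_form b p v"
    have r: "?r > 0" using p by (simp add: M_def)
    have br: "b * ?r \<ge> 0" using r b by simp
    define A where "A = (b * ?r + 2) / (b * ?r + 1)"
    define B where "B = (b * ?r + 1) / (b * ?r + 2)"
    define C where "C = 2 * (b * ?r + 2)"
    have ABC: "A > 0" "B > 0" "C > 0" using br by (simp_all add: A_def B_def C_def add_nonneg_pos)
    have h: "h_metric b p v v = 1 / (4 * ?r\<^sup>2) *
       (A * (v $ 1)\<^sup>2 + B * ?f\<^sup>2 + C * ((v $ 4)\<^sup>2 + (v $ 3)\<^sup>2))"
      by (simp add: h_metric_def A_def B_def C_def power2_eq_square Let_def)
    \<comment> \<open>If \<open>v $ 3\<close> and \<open>v $ 4\<close> vanish, then the fibre form evaluates to \<open>v $ 2\<close>.\<close>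
    have "v $ 1 \<noteq> 0 \<or> ?f \<noteq> 0 \<or> v $ 3 \<noteq> 0 \<or> v $ 4 \<noteq> 0"
      using v by (auto simp: fibre_form_def vec_eq_iff forall_4)
    then have "A * (v $ 1)\<^sup>2 > 0 \<or> B * ?f\<^sup>2 > 0 \<or> C * ((v $ 4)\<^sup>2 + (v $ 3)\<^sup>2) > 0"
      using ABC by (auto simp: sum_power2_gt_zero_iff)
    moreover have "A * (v $ 1)\<^sup>2 \<ge> 0" "B * ?f\<^sup>2 \<ge> 0" "C * ((v $ 4)\<^sup>2 + (v $ 3)\<^sup>2) \<ge> 0"
      using ABC by auto
    ultimately have "A * (v $ 1)\<^sup>2 + B * ?f\<^sup>2 + C * ((v $ 4)\<^sup>2 + (v $ 3)\<^sup>2) > 0" by linarith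
    then show ?thesis unfolding h using r by simp
  qed
  have "rational_on M (\<lambda>p. h_metric b p v w)" for v w
  proof (rule rational_on_h_metric)
    show "rational_on M (\<lambda>p::real^4. p $ i)" for i
      by (rule rational_on.linear[OF bounded_linear_vec_nth])
    show "0 < b * p $ 1 + 1" if "p \<in> M" for p
      using that b by (simp add: M_def add_nonneg_pos)
  qed (simp_all add: rational_on.const M_def)
  then have "smooth_on M (\<lambda>p. h_metric b p v w)" for v w
    unfolding smooth_on_def
    using rational_on_imp_C_diff_on[OF open_M] open_M
    by (intro exI[of _ M] exI[of _ "\<lambda>p. h_metric b p v w"]) simp
  with bil sym pos show ?thesis unfolding riemannian_metric_on_def by blast
qed

lemma uniform_limit_h_metric:
  assumes K: "compact K" "K \<subseteq> M"
  shows "uniform_limit K (\<lambda>b p. h_metric b p v w) (\<lambda>p. h_metric 0 p v w) (at_right 0)"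
proof (rule uniform_limitI)
  fix e :: real assume e: "e > 0"
  let ?h = "\<lambda>(b, p). h_metric b p v w"
  obtain U F where UF: "{0..} \<times> M \<subseteq> U" "\<And>x. x \<in> {0..} \<times> M \<Longrightarrow> F x = ?h x"
    "\<And>k. C_diff_on k U F"
    using smooth_on_h_metric[of v w] unfolding smooth_on_def by blast
  have sub: "{0..1} \<times> K \<subseteq> {0..} \<times> M" using K by auto
  have "continuous_on ({0..1} \<times> K) F"
    using UF(3)[of 0] UF(1) sub by (auto intro: continuous_on_subset)
  then have "continuous_on ({0..1} \<times> K) ?h"
    using UF(2) sub by (subst continuous_on_cong[OF refl, of _ _ F]) auto
  then have "uniformly_continuous_on ({0..1} \<times> K) ?h"
    using K by (intro compact_uniformly_continuous compact_Times) auto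
  then obtain d where d: "d > 0" "\<And>x x'. \<lbrakk>x \<in> {0..1} \<times> K; x' \<in> {0..1} \<times> K; dist x' x < d\<rbrakk>
      \<Longrightarrow> dist (?h x') (?h x) < e"
    using e unfolding uniformly_continuous_on_def by blast
  have "\<forall>p\<in>K. dist (h_metric b p v w) (h_metric 0 p v w) < e" if "0 < b" "b < min d 1" for b
    using that d(2)[of "(0, _)" "(b, _)"] by (auto simp: dist_Pair_Pair)
  then show "\<forall>\<^sub>F b in at_right 0. \<forall>p\<in>K. dist (h_metric b p v w) (h_metric 0 p v w) < e"
    unfolding eventually_at_right_field using d(1) by (intro exI[of _ "min d 1"]) auto
qed

section \<open>Curvature of half-space metrics\<close>

text \<open>The component \<open>p $ e\<close> is the height above the boundary of the half-space.\<close>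

definition diag_metric :: "('n \<Rightarrow> real) \<Rightarrow> 'n \<Rightarrow> 'n::finite metric_field" where
  "diag_metric a e p v w = (\<Sum>i\<in>UNIV. a i * v $ i * w $ i) / (p $ e)\<^sup>2"

text \<open>The Christoffel symbols, up to the factor \<open>-1 / p $ e\<close> (see \<open>christoffel_diag_metric\<close>).\<close>

definition connection_coeff :: "('n \<Rightarrow> real) \<Rightarrow> 'n \<Rightarrow> 'n \<Rightarrow> 'n \<Rightarrow> 'n \<Rightarrow> real" where
  "connection_coeff a e k i j = (if j = k \<and> i = e then 1 else 0) + (if i = k \<and> j = e then 1 else 0)
     - (if i = j \<and> k = e then a i / a k else 0)"

lemma gram_diag_metric:
  "gram (diag_metric a e) p = (\<chi> i j. if i = j then a i / (p $ e)\<^sup>2 else 0)"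
proof -
  have "(\<Sum>m\<in>UNIV. a m * axis i 1 $ m * axis j 1 $ m) = (if i = j then a i else 0)" for i j
  proof -
    have "a m * axis i 1 $ m * axis j 1 $ m = (if m = i then if i = j then a i else 0 else 0)" for m
      by (auto simp: axis_def)
    then show ?thesis by simp
  qed
  then show ?thesis by (simp add: gram_def diag_metric_def vec_eq_iff)
qed

lemma matrix_inv_unique:
  fixes A B :: "'a::semiring_1^'n^'n"
  assumes "A ** B = mat 1" "B ** A = mat 1"
  shows "matrix_inv A = B"
proof -
  have "A ** matrix_inv A = mat 1 \<and> matrix_inv A ** A = mat 1"
    unfolding matrix_inv_def by (rule someI[of _ B]) (use assms in auto)
  then show ?thesis
    using assms by (metis matrix_mul_assoc matrix_mul_lid matrix_mul_rid)
qed

lemma matrix_inv_diag: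
  fixes d :: "'n::finite \<Rightarrow> real"
  assumes "\<And>i. d i \<noteq> 0"
  shows "matrix_inv (\<chi> i j. if i = j then d i else 0) = (\<chi> i j. if i = j then 1 / d i else 0)"
proof (rule matrix_inv_unique)
  have *: "(\<Sum>k\<in>UNIV. (if i = k then c else 0) * (if k = j then g k else 0))
      = (if i = j then c * g i else (0::real))" for c g and i j :: 'n
  proof -
    have "(if i = k then c else 0) * (if k = j then g k else 0)
        = (if k = i then if i = j then c * g i else 0 else 0)" for k
      by auto
    then show ?thesis by simp
  qed
  show "(\<chi> i j. if i = j then d i else 0) ** (\<chi> i j. if i = j then 1 / d i else 0) = mat 1"
    "(\<chi> i j. if i = j then 1 / d i else 0) ** (\<chi> i j. if i = j then d i else 0) = mat 1"
    using assms by (auto simp: matrix_matrix_mult_def mat_def vec_eq_iff *)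
qed

lemma pderiv_at_eqI: "(f has_derivative f') (at p) \<Longrightarrow> pderiv_at i f p = f' (axis i 1)"
  unfolding pderiv_at_def using frechet_derivative_at by metis

lemma christoffel_diag_metric:
  assumes a: "\<And>i. a i \<noteq> 0" and p: "p $ e \<noteq> 0"
  shows "christoffel (diag_metric a e) k i j p = - connection_coeff a e k i j / p $ e"
proof -
  have d: "pderiv_at i (\<lambda>q. gram (diag_metric a e) q $ j $ l) p
      = -2 / (p $ e)^3 * (if j = l \<and> i = e then a j else 0)" for i j l
  proof -
    have "((\<lambda>q. a j / (q $ e)\<^sup>2) has_derivative (\<lambda>v. -2 * a j * v $ e / (p $ e)^3)) (at p)"
      using p by (auto intro!: derivative_eq_intros bounded_linear.has_derivative[OF bounded_linear_vec_nth] ext simp: field_simps power2_eq_square power3_eq_cube)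
    from pderiv_at_eqI[OF this, of i] show ?thesis
      using pderiv_at_eqI[OF has_derivative_const, of i 0 p]
      by (cases "j = l") (auto simp: gram_diag_metric axis_def)
  qed
  have i: "matrix_inv (gram (diag_metric a e) p) $ k $ l = (if l = k then (p $ e)\<^sup>2 / a k else 0)" for l
    unfolding gram_diag_metric using a p by (subst matrix_inv_diag) auto
  have scale: "(1/2) * ((p $ e)\<^sup>2 / a k * (-2 / (p $ e)^3 * A + -2 / (p $ e)^3 * B - -2 / (p $ e)^3 * C))
      = - ((A + B - C) / a k) / p $ e" for A B C
    using a p by (simp add: field_simps power2_eq_square power3_eq_cube)
  have "christoffel (diag_metric a e) k i j p = (1/2) * ((p $ e)\<^sup>2 / a k *
      (-2 / (p $ e)^3 * (if j = k \<and> i = e then a j else 0)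
       + -2 / (p $ e)^3 * (if i = k \<and> j = e then a i else 0)
       - -2 / (p $ e)^3 * (if i = j \<and> k = e then a i else 0)))"
    unfolding christoffel_def d i
    by (simp only: if_distrib[of "\<lambda>x. x * _"] mult_zero_left sum.delta finite UNIV_I if_True)
  also have "\<dots> = - connection_coeff a e k i j / p $ e"
  proof -
    have "connection_coeff a e k i j = ((if j = k \<and> i = e then a j else 0)
        + (if i = k \<and> j = e then a i else 0) - (if i = j \<and> k = e then a i else 0)) / a k"
      by (auto simp: connection_coeff_def a add_divide_distrib diff_divide_distrib)
    then show ?thesis unfolding scale by simp
  qed
  finally show ?thesis .
qed

text \<open>The contraction in the quadratic part of the curvature: each Kronecker delta in
  \<open>connection_coeff\<close> picks a single summand.\<close>

lemma connection_coeff_sum: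
  fixes f :: "'n::finite \<Rightarrow> real"
  shows   "(\<Sum>m\<in>UNIV. connection_coeff a e l i m * f m) = (if i = e then f l else 0) + (if i = l then f e else 0)
     - (if l = e then a i / a l * f i else 0)"
proof -
  have "connection_coeff a e l i m * f m = (if m = l then if i = e then f l else 0 else 0)
     + (if m = e then if i = l then f e else 0 else 0)
     - (if m = i then if l = e then a i / a l * f i else 0 else 0)" for m
    by (auto simp: connection_coeff_def algebra_simps)
  then show ?thesis by (simp add: sum.distrib sum_subtractf)
qed

text \<open>Differentiating \<open>-1 / p $ e\<close> gives \<open>1 / (p $ e)\<^sup>2\<close>, the same factor as in the products of two
  Christoffel symbols. So the dependence on \<open>p\<close> factors out and an identity between constants
  remains.\<close>

lemma riemann_coeff_diag_metric:
  fixes p :: "real^'n::finite"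
  assumes a: "\<And>i. a i \<noteq> 0" and p: "p $ e \<noteq> 0"
  shows "riemann_coeff (diag_metric a e) l i j k p =
    - 1 / a e * ((if j = k then a j else 0) * (if l = i then 1 else 0)
      - (if i = k then a i else 0) * (if l = j then 1 else 0)) / (p $ e)\<^sup>2"
proof -
  have U: "open {q::real^'n. q $ e \<noteq> 0}"
    by (intro open_Collect_neq continuous_intros)
  have d: "pderiv_at i (christoffel (diag_metric a e) l j k) p
      = (if i = e then connection_coeff a e l j k / (p $ e)\<^sup>2 else 0)" for i l j k
  proof -
    have "((\<lambda>q. - connection_coeff a e l j k / q $ e) has_derivative (\<lambda>v. connection_coeff a e l j k * v $ e / (p $ e)\<^sup>2)) (at p)"
      using p by (auto intro!: derivative_eq_intros bounded_linear.has_derivative[OF bounded_linear_vec_nth] ext simp: field_simps power2_eq_square)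
    then have "(christoffel (diag_metric a e) l j k has_derivative (\<lambda>v. connection_coeff a e l j k * v $ e / (p $ e)\<^sup>2)) (at p)"
      by (rule has_derivative_transform_within_open[OF _ U]) (use a p in \<open>auto simp: christoffel_diag_metric\<close>)
    from pderiv_at_eqI[OF this, of i] show ?thesis by (auto simp: axis_def)
  qed
  have s: "(\<Sum>m\<in>UNIV. - connection_coeff a e l i m / p $ e * (- connection_coeff a e m j k / p $ e)
        - - connection_coeff a e l j m / p $ e * (- connection_coeff a e m i k / p $ e))
     = ((\<Sum>m\<in>UNIV. connection_coeff a e l i m * connection_coeff a e m j k) - (\<Sum>m\<in>UNIV. connection_coeff a e l j m * connection_coeff a e m i k)) / (p $ e)\<^sup>2"
    by (simp add: sum_subtractf diff_divide_distrib sum_divide_distrib power2_eq_square)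
  have n: "(if i = e then connection_coeff a e l j k else 0) - (if j = e then connection_coeff a e l i k else 0)
      + ((\<Sum>m\<in>UNIV. connection_coeff a e l i m * connection_coeff a e m j k) - (\<Sum>m\<in>UNIV. connection_coeff a e l j m * connection_coeff a e m i k))
    = - 1 / a e * ((if j = k then a j else 0) * (if l = i then 1 else 0)
      - (if i = k then a i else 0) * (if l = j then 1 else 0))"
    unfolding connection_coeff_sum by (auto simp: connection_coeff_def a)
  have "riemann_coeff (diag_metric a e) l i j k p
    = ((if i = e then connection_coeff a e l j k else 0) - (if j = e then connection_coeff a e l i k else 0)
      + ((\<Sum>m\<in>UNIV. connection_coeff a e l i m * connection_coeff a e m j k) - (\<Sum>m\<in>UNIV. connection_coeff a e l j m * connection_coeff a e m i k)))
      / (p $ e)\<^sup>2"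
    unfolding riemann_coeff_def d christoffel_diag_metric[OF a p] s
    by (simp add: add_divide_distrib diff_divide_distrib)
  then show ?thesis unfolding n .
qed

lemma riemann_diag_metric:
  assumes a: "\<And>i. a i \<noteq> 0" and p: "p $ e \<noteq> 0"
  shows "riemann (diag_metric a e) p u v w =
    (- 1 / a e) *\<^sub>R (diag_metric a e p v w *\<^sub>R u - diag_metric a e p u w *\<^sub>R v)"
proof -
  have "(\<Sum>i\<in>UNIV. \<Sum>j\<in>UNIV. \<Sum>k\<in>UNIV. riemann_coeff (diag_metric a e) l i j k p * u $ i * v $ j * w $ k)
    = - 1 / a e * (diag_metric a e p v w * u $ l - diag_metric a e p u w * v $ l)" for l
  proof -
    let ?c = "- 1 / a e / (p $ e)\<^sup>2"
    have "riemann_coeff (diag_metric a e) l i j k p * u $ i * v $ j * w $ k =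
       ?c * ((if j = k then if l = i then u $ i * (a j * v $ j * w $ j) else 0 else 0)
        - (if i = k then if l = j then v $ j * (a i * u $ i * w $ i) else 0 else 0))" for i j k
      unfolding riemann_coeff_diag_metric[OF a p] by (auto simp: field_simps)
    then have "(\<Sum>i\<in>UNIV. \<Sum>j\<in>UNIV. \<Sum>k\<in>UNIV. riemann_coeff (diag_metric a e) l i j k p * u $ i * v $ j * w $ k)
      = ?c * ((\<Sum>i\<in>UNIV. \<Sum>j\<in>UNIV. if l = i then u $ i * (a j * v $ j * w $ j) else 0)
          - (\<Sum>i\<in>UNIV. \<Sum>j\<in>UNIV. if l = j then v $ j * (a i * u $ i * w $ i) else 0))"
      by (simp only: sum_distrib_left[symmetric] sum_subtractf) (simp only: sum.delta sum.delta' finite UNIV_I if_True if_False)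
    also have "\<dots> = ?c * ((\<Sum>j\<in>UNIV. u $ l * (a j * v $ j * w $ j)) - (\<Sum>i\<in>UNIV. v $ l * (a i * u $ i * w $ i)))"
      by (subst sum.swap) simp
    also have "\<dots> = - 1 / a e * (diag_metric a e p v w * u $ l - diag_metric a e p u w * v $ l)"
      unfolding sum_distrib_left[symmetric] diag_metric_def
      by (simp add: mult_ac diff_divide_distrib right_diff_distrib)
    finally show ?thesis .
  qed
  then show ?thesis by (simp add: riemann_def vec_eq_iff)
qed

text \<open>The strict Cauchy-Schwarz inequality, obtained by evaluating the form on the vector
  \<open>B(v,v) u - B(u,v) v\<close>, which is orthogonal to \<open>v\<close>. It makes the denominator of the sectional
  curvature nonzero.\<close>

lemma gram_determinant_pos:
  fixes B :: "'a::euclidean_space \<Rightarrow> 'a \<Rightarrow> real"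
  assumes "bilinear B" and sym: "\<And>v w. B v w = B w v" and pos: "\<And>v. v \<noteq> 0 \<Longrightarrow> 0 < B v v"
    and uv: "u \<noteq> v" "independent {u, v}"
  shows "0 < B u u * B v v - (B u v)\<^sup>2"
proof -
  interpret bilinear: bounded_bilinear B
    using assms(1) by (simp add: bilinear_conv_bounded_bilinear)
  let ?w = "B v v *\<^sub>R u - B u v *\<^sub>R v"
  have v: "v \<noteq> 0" using uv dependent_zero by blast
  have "?w \<noteq> 0"
  proof
    assume "?w = 0"
    then have "u = (B u v / B v v) *\<^sub>R v"
      using pos[OF v] by (simp add: eq_vector_fraction_iff)
    then have "u \<in> span {v}" by (metis span_base span_scale singletonI)
    moreover have "{u, v} - {u} = {v}" using uv by auto
    ultimately show False using uv(2) unfolding dependent_def by auto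
  qed
  then have "0 < B ?w ?w" by (rule pos)
  also have "B ?w ?w = B v v * (B u u * B v v - (B u v)\<^sup>2)"
    by (simp add: bilinear.diff_left bilinear.diff_right bilinear.scaleR_left bilinear.scaleR_right
        sym[of v u] power2_eq_square algebra_simps)
  finally show ?thesis using pos[OF v] by (simp add: zero_less_mult_iff)
qed

lemma sectional_curvature_diag_metric:
  assumes a: "\<And>i. a i > 0" and p: "p $ e \<noteq> 0" and uv: "u \<noteq> v" "independent {u, v}"
  shows "sectional_curvature (diag_metric a e) p u v = - 1 / a e"
proof -
  let ?g = "diag_metric a e p"
  have bil: "bilinear ?g"
    unfolding bilinear_def diag_metric_def
    by (auto intro!: linearI simp: algebra_simps sum.distrib add_divide_distrib sum_distrib_left)
  have sym: "?g v w = ?g w v" for v w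
    by (simp add: diag_metric_def mult_ac)
  have pos: "0 < ?g v v" if "v \<noteq> 0" for v
  proof -
    obtain i where i: "v $ i \<noteq> 0" using \<open>v \<noteq> 0\<close> by (auto simp: vec_eq_iff)
    have "0 < (\<Sum>i\<in>UNIV. a i * v $ i * v $ i)"
    proof (rule sum_pos2[of _ i])
      show "0 < a i * v $ i * v $ i" using a[of i] i by (metis mult.assoc mult_pos_pos not_real_square_gt_zero)
      show "0 \<le> a j * v $ j * v $ j" for j using a[of j] by (simp add: mult.assoc)
    qed auto
    then show ?thesis using p by (simp add: diag_metric_def)
  qed
  have a0: "a i \<noteq> 0" for i using a[of i] by simp
  interpret bilinear: bounded_bilinear ?g
    using bil by (simp add: bilinear_conv_bounded_bilinear)
  have "?g (riemann (diag_metric a e) p u v v) u = - 1 / a e * (?g u u * ?g v v - (?g u v)\<^sup>2)"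
    unfolding riemann_diag_metric[OF a0 p]
    by (simp add: bilinear.scaleR_left bilinear.diff_left bilinear.minus_left sym[of v u] power2_eq_square algebra_simps diff_divide_distrib)
  with gram_determinant_pos[OF bil sym pos uv] show ?thesis
    unfolding sectional_curvature_def by simp
qed

section \<open>The limit\<close>

lemma h_metric_0:
  "h_metric 0 p v w = 1 / (4 * (p $ 1)\<^sup>2) *
     (2 * (v $ 1 * w $ 1) + (1 / 2) * (v $ 2 * w $ 2) + 4 * (v $ 4 * w $ 4) + 4 * (v $ 3 * w $ 3))"
  by (simp add: h_metric_def fibre_form_def Let_def algebra_simps)

lemma h_metric_0_eq_diag_metric:
  "h_metric 0 = diag_metric (\<lambda>i. if i = 1 then 1/2 else if i = 2 then 1/8 else 1) 1"
  by (intro ext) (simp add: h_metric_0 diag_metric_def sum_4 field_simps)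

text \<open>The factors are the square roots of \<open>a\<^sub>i / a\<^sub>1\<close>, where \<open>a = (1/2, 1/8, 1, 1)\<close> are the constants
  in \<open>h_metric_0_eq_diag_metric\<close>.\<close>

lemma pullback_half_space_metric:
  "pullback (stretch (\<lambda>i. if i = 1 then 1 else if i = 2 then 1/2 else sqrt 2)) (half_space_metric (-2)) p v w
     = h_metric 0 p v w"
  unfolding pullback_stretch
  by (simp add: h_metric_0 half_space_metric_def stretch_def inner_vec_def sum_4 field_simps)

theorem mainTheorem3:
  shows "(\<forall>c>0. diffeomorphism_on M M (coord_change (1 / c)) \<and>
             (\<forall>p\<in>M. \<forall>v w. pullback (coord_change (1 / c)) (g_metric c) p v w
                = h_metric (1 / c) p v w)) \<and>
         (\<forall>b\<ge>0. riemannian_metric_on M (h_metric b)) \<and>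
         (\<forall>v w. smooth_on ({0..} \<times> M) (\<lambda>(b, p). h_metric b p v w)) \<and>
         (\<forall>p\<in>M. \<forall>v w. h_metric 0 p v w =
             1 / (4 * (p $ 1)\<^sup>2) *
               (2 * (v $ 1 * w $ 1) + (1 / 2) * (v $ 2 * w $ 2)
                + 4 * (v $ 4 * w $ 4) + 4 * (v $ 3 * w $ 3))) \<and>
         constant_sectional_curvature_on M (h_metric 0) (-2) \<and>
         (\<exists>\<Psi>. diffeomorphism_on M M \<Psi> \<and>
             (\<forall>p\<in>M. \<forall>v w. pullback \<Psi> (half_space_metric (-2)) p v w = h_metric 0 p v w)) \<and>
         (\<forall>v w K. compact K \<and> K \<subseteq> M \<longrightarrow>
             uniform_limit K (\<lambda>c p. pullback (coord_change (1 / c)) (g_metric c) p v w)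
               (\<lambda>p. h_metric 0 p v w) at_top)"
proof (intro conjI allI impI ballI)
  fix c :: real assume "c > 0"
  then show "diffeomorphism_on M M (coord_change (1 / c))"
    unfolding coord_change_eq_stretch by (intro diffeomorphism_on_stretch) auto
next
  show "constant_sectional_curvature_on M (h_metric 0) (-2)"
    unfolding constant_sectional_curvature_on_def h_metric_0_eq_diag_metric
    by (auto simp: M_def sectional_curvature_diag_metric)
next
  show "\<exists>\<Psi>. diffeomorphism_on M M \<Psi> \<and>
      (\<forall>p\<in>M. \<forall>v w. pullback \<Psi> (half_space_metric (-2)) p v w = h_metric 0 p v w)"
    using pullback_half_space_metric diffeomorphism_on_stretch
    by (intro exI[of _ "stretch (\<lambda>i. if i = 1 then 1 else if i = 2 then 1/2 else sqrt 2)"]) auto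
next
  fix v w K assume "compact K \<and> K \<subseteq> M"
  then have K: "compact K" "K \<subseteq> M" by auto
  have "filterlim (\<lambda>c::real. 1 / c) (at_right 0) at_top"
    using filterlim_inverse_at_right_top by (simp add: inverse_eq_divide)
  then have "uniform_limit K (\<lambda>c p. h_metric (1 / c) p v w) (\<lambda>p. h_metric 0 p v w) at_top"
    by (rule filterlim_compose[OF uniform_limit_h_metric[OF K]])
  moreover have "\<forall>\<^sub>F c in at_top. \<forall>p\<in>K.
      h_metric (1 / c) p v w = pullback (coord_change (1 / c)) (g_metric c) p v w"
    using eventually_gt_at_top[of 0] by eventually_elim (use K pullback_coord_change in force)
  ultimately show "uniform_limit K (\<lambda>c p. pullback (coord_change (1 / c)) (g_metric c) p v w)
      (\<lambda>p. h_metric 0 p v w) at_top"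
    by (rule uniform_limit_cong[THEN iffD1, rotated 2]) auto
qed (auto simp: pullback_coord_change riemannian_metric_on_h_metric smooth_on_h_metric h_metric_0)

end
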